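(* Let $k\ge 2$ be an integer and define $$c_k=\frac{2^{2k}}{(k-1)!}.$$ Let $d\ge k$ be an integer. For $j=1,2$ let $\Omega^{(j)}=\Omega^{(j)}_1\times\cdots\times\Omega^{(j)}_d\subset\mathbb{R}^d$, where each $\Omega^{(j)}_i\subset\mathbb{R}$ is a nondegenerate interval symmetric about $0$ (possibly unbounded), and let $\varrho^{(j)}(\mathbf{x})=\varrho^{(j)}_1(x_1)\cdots\varrho^{(j)}_d(x_d)$ be a weight function on $\Omega^{(j)}$, where each $\varrho^{(j)}_i:\Omega^{(j)}_i\to[0,\infty)$ satisfies $\varrho^{(j)}_i(x)=\varrho^{(j)}_i(-x)$ and $\int_{\Omega^{(j)}_i}\varrho^{(j)}_i(x)\,dx>0$, and all univariate polynomials are integrable with respect to $\varrho^{(j)}_i(x)\,dx$ on $\Omega^{(j)}_i$. Then $$\bigl|N_{\min}(2k+1,d,\varrho^{(1)})-N_{\min}(2k+1,d,\varrho^{(2)})\bigr|\le c_k\,d^{k-1}.$$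
   Context: For a region $\Omega\subset\mathbb{R}^d$ and a weight function $\varrho$ on $\Omega$, put $I_d^\varrho(f)=\int_\Omega f(\mathbf{x})\varrho(\mathbf{x})\,d\mathbf{x}$. A cubature formula with $n$ knots for $I_d^\varrho$ is a functional $Q_n(f)=\sum_{i=1}^n a_i f(\mathbf{x}_i)$ with real (possibly negative) weights $a_i\in\mathbb{R}$ and knots $\mathbf{x}_i\in\Omega$. Let $\mathbb{P}(\ell,d)$ be the space of all real polynomials in $d$ variables of total degree at most $\ell$. The formula $Q_n$ has degree $\ell$ of exactness if $Q_n(f)=I_d^\varrho(f)$ for all $f\in\mathbb{P}(\ell,d)$. The number $N_{\min}(\ell,d,\varrho)$ is the minimal number $n$ of knots needed by any cubature formula $Q_n$ for $I_d^\varrho$ with degree $\ell$ of exactness (the region $\Omega$ is understood to be part of the data of $\varrho$). *)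

theory Defs
  imports "HOL-Analysis.Analysis" "HOL-Computational_Algebra.Polynomial"
begin

text \<open>Real polynomial functions of total degree at most \<open>l\<close> on \<open>real ^ 'd\<close>; an exponent
  vector is a function \<open>\<alpha> :: 'd \<Rightarrow> nat\<close>, and the index set of the sum is finite because \<open>'d\<close> is.\<close>

definition polynomials_upto :: "nat \<Rightarrow> ((real ^ 'd) \<Rightarrow> real) set" where
  "polynomials_upto l =
     {f. \<exists>c :: ('d \<Rightarrow> nat) \<Rightarrow> real.
           f = (\<lambda>x. \<Sum>\<alpha> | (\<Sum>i\<in>UNIV. \<alpha> i) \<le> l. c \<alpha> * (\<Prod>i\<in>UNIV. (x $ i) ^ \<alpha> i))}"

definition weighted_integral ::
    "(real ^ 'd) set \<Rightarrow> ((real ^ 'd) \<Rightarrow> real) \<Rightarrow> ((real ^ 'd) \<Rightarrow> real) \<Rightarrow> real" where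
  "weighted_integral \<Omega> \<rho> f = (LINT x:\<Omega>|lebesgue. f x * \<rho> x)"

definition cubature :: "nat \<Rightarrow> (nat \<Rightarrow> real) \<Rightarrow> (nat \<Rightarrow> real ^ 'd) \<Rightarrow> ((real ^ 'd) \<Rightarrow> real) \<Rightarrow> real" where
  "cubature n a x f = (\<Sum>i<n. a i * f (x i))"

definition has_degree_of_exactness ::
    "nat \<Rightarrow> (real ^ 'd) set \<Rightarrow> ((real ^ 'd) \<Rightarrow> real) \<Rightarrow> nat \<Rightarrow> (nat \<Rightarrow> real) \<Rightarrow> (nat \<Rightarrow> real ^ 'd) \<Rightarrow> bool"
  where
  "has_degree_of_exactness l \<Omega> \<rho> n a x \<longleftrightarrow>
     (\<forall>f \<in> polynomials_upto l. cubature n a x f = weighted_integral \<Omega> \<rho> f)"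

definition N_min :: "nat \<Rightarrow> (real ^ 'd) set \<Rightarrow> ((real ^ 'd) \<Rightarrow> real) \<Rightarrow> nat" where
  "N_min l \<Omega> \<rho> =
     (LEAST n. \<exists>a x. (\<forall>i<n. x i \<in> \<Omega>) \<and> has_degree_of_exactness l \<Omega> \<rho> n a x)"

definition product_region :: "('d \<Rightarrow> real set) \<Rightarrow> (real ^ 'd) set" where
  "product_region \<Omega> = {x. \<forall>i. x $ i \<in> \<Omega> i}"

definition product_weight :: "('d \<Rightarrow> real \<Rightarrow> real) \<Rightarrow> (real ^ 'd) \<Rightarrow> real" where
  "product_weight \<rho> x = (\<Prod>i\<in>UNIV. \<rho> i (x $ i))"

definition symmetric_interval :: "real set \<Rightarrow> bool" where
  "symmetric_interval \<Omega> \<longleftrightarrow>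
     is_interval \<Omega> \<and> (\<exists>x\<in>\<Omega>. \<exists>y\<in>\<Omega>. x \<noteq> y) \<and> (\<forall>x. x \<in> \<Omega> \<longleftrightarrow> - x \<in> \<Omega>)"

text \<open>The values of \<open>\<rho>\<close> outside \<open>\<Omega>\<close> are irrelevant. Lebesgue measurability of \<open>\<rho>\<close> on \<open>\<Omega>\<close> is
  part of the integrability condition (take the constant polynomial).\<close>

definition symmetric_weight :: "real set \<Rightarrow> (real \<Rightarrow> real) \<Rightarrow> bool" where
  "symmetric_weight \<Omega> \<rho> \<longleftrightarrow>
     (\<forall>x\<in>\<Omega>. \<rho> x \<ge> 0) \<and> (\<forall>x\<in>\<Omega>. \<rho> x = \<rho> (- x)) \<and>
     (\<forall>p :: real poly. (\<lambda>x. poly p x * \<rho> x) absolutely_integrable_on \<Omega>) \<and>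
     (LINT x:\<Omega>|lebesgue. \<rho> x) > 0"

definition c_const :: "nat \<Rightarrow> real" where
  "c_const k = 2 ^ (2 * k) / fact (k - 1)"

end

theory Submission
  imports Defs
begin

text \<open>Write \<open>d\<close> for the dimension. A formula of degree \<open>2 * k + 1\<close> for one weight becomes a formula for the
  other weight at the price of at most \<open>c_const k * d ^ (k - 1)\<close> further knots, and the theorem
  follows by exchanging the two weights.

  For a product weight the integral of a monomial is the product of the one-variable moments,
  which vanish in odd degree. Dilate the knots of the given formula coordinatewise by factors
  \<open>t * s i\<close>, with \<open>t\<close> so small that they land in the new region (a neighbourhood of \<open>0\<close>), and
  multiply the weights by a common constant. This changes the functional on the monomial \<open>x ^ \<alpha>\<close>
  by a factor that is a product over the coordinates, up to the power \<open>t ^ \<bar>\<alpha>\<bar>\<close>. The \<open>s i\<close> and the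
  constant can be chosen such that the moments of orders \<open>0\<close> and \<open>2\<close> become those of the new
  weight, the power of \<open>t\<close> being compensated in the single degree \<open>2 * k\<close>. So the new functional is
  correct on every monomial of degree at most \<open>2 * k + 1\<close> that is odd in some variable, and on the
  products of \<open>k\<close> distinct squares \<open>(x i)\<^sup>2\<close>. Weights may be negative and large, so a tiny \<open>t\<close> does no harm.

  An even monomial of degree at most \<open>2 * k\<close> that is not a product of \<open>k\<close> distinct squares involves
  fewer than \<open>k\<close> variables. The defect on these remaining monomials \<open>x ^ (2 * \<beta>)\<close> is repaired with
  knots that are small multiples of integer points \<open>\<gamma>\<close> such that the vector of all \<open>\<bar>\<gamma> i\<bar>\<close> is again
  such an exponent vector \<open>\<beta>\<close>: these exponents form a down-closed set, so products of central
  differences give a triangular and hence solvable system (\<open>interpolation_down_closed\<close>). The repair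
  leaves the odd monomials alone by symmetry, and the products of \<open>k\<close> distinct squares because
  each of its knots has fewer than \<open>k\<close> nonzero coordinates (\<open>cubature_transfer\<close>).

  Finally there are few such \<open>\<gamma>\<close>: at most \<open>2 ^ k * 2 ^ s\<close> have a given support of size \<open>s\<close>, and
  every \<open>d choose s\<close> with \<open>s < k \<le> d\<close> is at most \<open>d ^ (k - 1) / fact (k - 1)\<close>; the geometric series
  in \<open>s\<close> contributes a second factor \<open>2 ^ k\<close> (\<open>card_signed_sparse_exponents\<close>).\<close>

section \<open>Difference functionals and interpolation on a down-closed set\<close>

text \<open>The absorption identity \<open>i * (n choose i) = n * (n - 1 choose i - 1)\<close> removes one factor \<open>i\<close> and lowers
  \<open>n\<close>; expanding the shifted power then leaves sums of smaller exponents for \<open>n - 1\<close>.\<close>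

lemma alternating_binomial_power_sum:
  "p \<le> n \<Longrightarrow> (\<Sum>i\<le>n. (-1) ^ i * real (n choose i) * real i ^ p) = (if p = n then (-1) ^ n * fact n else 0)"
proof (induction n arbitrary: p)
  case 0
  then show ?case by simp
next
  case (Suc n)
  show ?case
  proof (cases p)
    case 0
    then show ?thesis
      using choose_alternating_sum[of "Suc n", where 'a = real] by simp
  next
    case (Suc q)
    then have q: "q \<le> n" using Suc.prems by simp
    have "(\<Sum>i\<le>Suc n. (-1) ^ i * real (Suc n choose i) * real i ^ p)
        = (\<Sum>i\<le>n. (-1) ^ Suc i * real (Suc n choose Suc i) * real (Suc i) ^ p)"
      using Suc by (subst sum.atMost_Suc_shift) simp
    also have "\<dots> = (\<Sum>i\<le>n. - real (Suc n) * ((-1) ^ i * real (n choose i) * real (Suc i) ^ q))"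
    proof (rule sum.cong[OF refl])
      fix i
      have "real (Suc n choose Suc i) * real (Suc i) = real (Suc n) * real (n choose i)"
        using Suc_times_binomial_eq[of n i] by (metis of_nat_mult mult.commute)
      then show "(-1) ^ Suc i * real (Suc n choose Suc i) * real (Suc i) ^ p
          = - real (Suc n) * ((-1) ^ i * real (n choose i) * real (Suc i) ^ q)"
        unfolding Suc by (simp add: algebra_simps del: binomial_Suc_Suc of_nat_Suc)
    qed
    also have "\<dots> = - real (Suc n) * (\<Sum>i\<le>n. (-1) ^ i * real (n choose i) *
        (\<Sum>r\<le>q. real (q choose r) * real i ^ r))"
      by (simp add: sum_distrib_left binomial_ring add.commute[of 1])
    also have "(\<Sum>i\<le>n. (-1) ^ i * real (n choose i) * (\<Sum>r\<le>q. real (q choose r) * real i ^ r))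
        = (\<Sum>r\<le>q. real (q choose r) * (\<Sum>i\<le>n. (-1) ^ i * real (n choose i) * real i ^ r))"
      unfolding sum_distrib_left by (subst sum.swap) (simp add: mult_ac)
    also have "\<dots> = (\<Sum>r\<le>q. if r = n then (-1) ^ n * fact n else 0)"
      using q by (intro sum.cong refl) (auto simp: Suc.IH)
    also have "- real (Suc n) * \<dots> = (if p = Suc n then (-1) ^ Suc n * fact (Suc n) else 0)"
      using q Suc by (auto simp: algebra_simps)
    finally show ?thesis .
  qed
qed

text \<open>The witness is the central difference of order \<open>2 * j\<close> at \<open>0\<close>, divided by \<open>fact (2 * j)\<close>. It is the
  one-variable building block of the triangular system solved below.\<close>

lemma central_difference_exists:
  "\<exists>\<omega> :: int \<Rightarrow> real. (\<forall>p. odd p \<or> p < 2 * j \<longrightarrow> (\<Sum>m=-int j..int j. \<omega> m * of_int m ^ p) = 0) \<and>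
     (\<Sum>m=-int j..int j. \<omega> m * of_int m ^ (2 * j)) = 1"
proof -
  define \<omega> :: "int \<Rightarrow> real" where
    "\<omega> m = (-1) ^ nat (m + int j) * real (2 * j choose nat (m + int j)) / fact (2 * j)" for m
  have reindex: "(\<Sum>m=-int j..int j. \<omega> m * f m)
      = (\<Sum>i\<le>2*j. (-1) ^ i * real (2 * j choose i) * f (int i - int j)) / fact (2 * j)" for f
    unfolding sum_divide_distrib
    by (rule sum.reindex_bij_witness[of _ "\<lambda>i. int i - int j" "\<lambda>m. nat (m + int j)"])
       (auto simp: \<omega>_def)
  have low: "(\<Sum>m=-int j..int j. \<omega> m * of_int m ^ p) = (if p = 2 * j then 1 else 0)" if p: "p \<le> 2 * j" for p
  proof -
    have "(\<Sum>i\<le>2*j. (-1) ^ i * real (2 * j choose i) * of_int (int i - int j) ^ p)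
        = (\<Sum>i\<le>2*j. (-1) ^ i * real (2 * j choose i) * 
            (\<Sum>r\<le>p. real (p choose r) * real i ^ r * (- real j) ^ (p - r)))"
      using binomial_ring[of "real _" "- real j" p] by simp
    also have "\<dots> = (\<Sum>r\<le>p. real (p choose r) * (- real j) ^ (p - r) *
        (\<Sum>i\<le>2*j. (-1) ^ i * real (2 * j choose i) * real i ^ r))"
      unfolding sum_distrib_left by (subst sum.swap) (simp add: mult_ac)
    also have "\<dots> = (\<Sum>r\<le>p. if r = 2 * j then fact (2 * j) else 0)"
      using p by (intro sum.cong refl) (auto simp: alternating_binomial_power_sum)
    also have "\<dots> = (if p = 2 * j then fact (2 * j) else 0)"
      using p by auto
    finally show ?thesis
      unfolding reindex by simp
  qed
  have odd: "(\<Sum>m=-int j..int j. \<omega> m * of_int m ^ p) = 0" if p: "odd p" for p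
  proof -
    have sym: "\<omega> (- m) = \<omega> m" if m: "m \<in> {-int j..int j}" for m
    proof -
      have eq: "nat (- m + int j) = 2 * j - nat (m + int j)" and le: "nat (m + int j) \<le> 2 * j"
        using m by auto
      have "(-1::real) ^ (2 * j - nat (m + int j)) = (-1) ^ nat (m + int j)"
        using le by (simp add: uminus_power_if)
      then show ?thesis
        unfolding \<omega>_def eq using binomial_symmetric[OF le] by simp
    qed
    have "(\<Sum>m=-int j..int j. \<omega> m * of_int m ^ p) = (\<Sum>m=-int j..int j. \<omega> (- m) * of_int (- m) ^ p)"
      by (rule sum.reindex_bij_witness[of _ uminus uminus]) auto
    also have "\<dots> = - (\<Sum>m=-int j..int j. \<omega> m * of_int m ^ p)"
      unfolding sum_negf[symmetric] using p by (intro sum.cong refl) (simp add: sym)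
    finally show ?thesis by simp
  qed
  show ?thesis
    using low odd by (intro exI[of _ \<omega>]) auto
qed

definition signed_points :: "('d \<Rightarrow> nat) set \<Rightarrow> ('d \<Rightarrow> int) set" where
  "signed_points T = {\<gamma>. (\<lambda>i. nat \<bar>\<gamma> i\<bar>) \<in> T}"

definition down_closed :: "('d \<Rightarrow> nat) set \<Rightarrow> bool" where
  "down_closed T \<longleftrightarrow> (\<forall>\<beta>\<in>T. \<forall>\<alpha>. (\<forall>i. \<alpha> i \<le> \<beta> i) \<longrightarrow> \<alpha> \<in> T)"

lemma finite_signed_points:
  fixes T :: "('d::finite \<Rightarrow> nat) set"
  assumes "finite T"
  shows "finite (signed_points T)"
proof -
  have "signed_points T \<subseteq> (\<Union>\<beta>\<in>T. PiE UNIV (\<lambda>i. {- int (\<beta> i)..int (\<beta> i)}))"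
    by (fastforce simp: signed_points_def PiE_UNIV_domain)
  then show ?thesis
    by (rule finite_subset) (auto intro!: finite_UN_I finite_PiE assms)
qed

text \<open>For \<open>\<beta> \<in> T\<close> the product \<open>u \<beta>\<close> of the central differences of orders \<open>2 * \<beta> i\<close> uses only points in
  the box of all \<open>\<gamma>\<close> with \<open>\<bar>\<gamma> i\<bar> \<le> \<beta> i\<close>, which are signed points of the down-closed set \<open>T\<close>. It
  annihilates all monomials that are odd in some variable and all \<open>x ^ (2 * \<alpha>)\<close> with \<open>\<alpha> i < \<beta> i\<close>
  for some \<open>i\<close>, and it takes \<open>x ^ (2 * \<beta>)\<close> to \<open>1\<close>. Ordered by degree, the linear system for the
  coefficients of the \<open>u \<beta>\<close> is therefore unitriangular, and it is solved degree by degree.\<close>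

lemma interpolation_down_closed:
  fixes T :: "('d::finite \<Rightarrow> nat) set" and L :: "('d \<Rightarrow> nat) \<Rightarrow> real"
  assumes fin: "finite T" and down: "down_closed T"
  obtains w :: "('d \<Rightarrow> int) \<Rightarrow> real"
  where "\<And>\<alpha>. \<exists>i. odd (\<alpha> i) \<Longrightarrow> (\<Sum>\<gamma>\<in>signed_points T. w \<gamma> * (\<Prod>i\<in>UNIV. of_int (\<gamma> i) ^ \<alpha> i)) = 0"
    and "\<And>\<beta>. \<beta> \<in> T \<Longrightarrow> (\<Sum>\<gamma>\<in>signed_points T. w \<gamma> * (\<Prod>i\<in>UNIV. of_int (\<gamma> i) ^ (2 * \<beta> i))) = L \<beta>"
proof -
  let ?G = "signed_points T"
  let ?M = "\<lambda>w \<alpha>. \<Sum>\<gamma>\<in>?G. w \<gamma> * (\<Prod>i\<in>UNIV. of_int (\<gamma> i) ^ \<alpha> i) :: real"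
  note finG = finite_signed_points[OF fin]
  have "\<exists>\<omega> :: nat \<Rightarrow> int \<Rightarrow> real. \<forall>j. (\<forall>p. odd p \<or> p < 2 * j \<longrightarrow> (\<Sum>m=-int j..int j. \<omega> j m * of_int m ^ p) = 0)
     \<and> (\<Sum>m=-int j..int j. \<omega> j m * of_int m ^ (2 * j)) = 1"
    using central_difference_exists by (intro choice allI)
  then obtain \<omega> :: "nat \<Rightarrow> int \<Rightarrow> real"
    where \<omega>0: "\<And>j p. odd p \<or> p < 2 * j \<Longrightarrow> (\<Sum>m=-int j..int j. \<omega> j m * of_int m ^ p) = 0"
      and \<omega>1: "\<And>j. (\<Sum>m=-int j..int j. \<omega> j m * of_int m ^ (2 * j)) = 1"
    by blast
  define box where "box \<beta> = PiE UNIV (\<lambda>i::'d. {- int (\<beta> i)..int (\<beta> i)})" for \<beta>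
  define u where "u \<beta> \<gamma> = (if \<gamma> \<in> box \<beta> then \<Prod>i\<in>UNIV. \<omega> (\<beta> i) (\<gamma> i) else 0)" for \<beta> \<gamma>
  have M_u: "?M (u \<beta>) \<alpha> = (\<Prod>i\<in>UNIV. \<Sum>m=-int (\<beta> i)..int (\<beta> i). \<omega> (\<beta> i) m * of_int m ^ \<alpha> i)"
    if "\<beta> \<in> T" for \<beta> \<alpha>
  proof -
    have "box \<beta> \<subseteq> ?G"
    proof
      fix \<gamma> assume "\<gamma> \<in> box \<beta>"
      then have "\<gamma> i \<in> {- int (\<beta> i)..int (\<beta> i)}" for i
        unfolding box_def by (rule PiE_mem) simp
      then have "nat \<bar>\<gamma> i\<bar> \<le> \<beta> i" for i
        by (auto simp: nat_le_iff abs_le_iff) (smt (verit))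
      then show "\<gamma> \<in> ?G"
        using down \<open>\<beta> \<in> T\<close> by (auto simp: down_closed_def signed_points_def)
    qed
    then have "?M (u \<beta>) \<alpha> = (\<Sum>\<gamma>\<in>box \<beta>. u \<beta> \<gamma> * (\<Prod>i\<in>UNIV. of_int (\<gamma> i) ^ \<alpha> i))"
      using finG by (intro sum.mono_neutral_right) (auto simp: u_def)
    also have "\<dots> = (\<Sum>\<gamma>\<in>box \<beta>. \<Prod>i\<in>UNIV. \<omega> (\<beta> i) (\<gamma> i) * of_int (\<gamma> i) ^ \<alpha> i)"
      by (simp add: u_def prod.distrib)
    also have "\<dots> = (\<Prod>i\<in>UNIV. \<Sum>m=-int (\<beta> i)..int (\<beta> i). \<omega> (\<beta> i) m * of_int m ^ \<alpha> i)"
      unfolding box_def by (rule prod_sum_PiE[symmetric]) auto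
    finally show ?thesis .
  qed
  have u_odd: "?M (u \<beta>) \<alpha> = 0" if "\<beta> \<in> T" "odd (\<alpha> i)" for \<alpha> \<beta> i
    unfolding M_u[OF that(1)] using that(2) by (intro prod_zero bexI[of _ i]) (auto simp: \<omega>0)
  have u_below: "?M (u \<beta>) (\<lambda>i. 2 * \<alpha> i) = 0" if "\<beta> \<in> T" "\<alpha> i < \<beta> i" for \<alpha> \<beta> i
    unfolding M_u[OF that(1)] using that(2) by (intro prod_zero bexI[of _ i]) (auto simp: \<omega>0)
  have u_diag: "?M (u \<beta>) (\<lambda>i. 2 * \<beta> i) = 1" if "\<beta> \<in> T" for \<beta>
    unfolding M_u[OF that] by (simp add: \<omega>1)
  have "\<exists>w. (\<forall>\<alpha>. (\<exists>i. odd (\<alpha> i)) \<longrightarrow> ?M w \<alpha> = 0) \<and>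
      (\<forall>\<beta>\<in>T. sum \<beta> UNIV < n \<longrightarrow> ?M w (\<lambda>i. 2 * \<beta> i) = L \<beta>)" for n
  proof (induction n)
    case 0
    show ?case by (rule exI[of _ "\<lambda>_. 0"]) simp
  next
    case (Suc n)
    then obtain w where w_odd: "\<And>\<alpha>. \<exists>i. odd (\<alpha> i) \<Longrightarrow> ?M w \<alpha> = 0"
      and w: "\<And>\<beta>. \<beta> \<in> T \<Longrightarrow> sum \<beta> UNIV < n \<Longrightarrow> ?M w (\<lambda>i. 2 * \<beta> i) = L \<beta>"
      by blast
    define Tn where "Tn = {\<beta>\<in>T. sum \<beta> UNIV = n}"
    \<comment> \<open>The error left on degree \<open>n\<close>; correcting it with the \<open>u \<beta>\<close> of that degree cannot
      disturb the lower degrees.\<close>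
    define e where "e \<beta> = L \<beta> - ?M w (\<lambda>i. 2 * \<beta> i)" for \<beta>
    define w' where "w' \<gamma> = w \<gamma> + (\<Sum>\<beta>\<in>Tn. e \<beta> * u \<beta> \<gamma>)" for \<gamma>
    have finTn: "finite Tn" and TnT: "\<And>\<beta>. \<beta> \<in> Tn \<Longrightarrow> \<beta> \<in> T"
      using fin by (auto simp: Tn_def)
    have M_w': "?M w' \<alpha> = ?M w \<alpha> + (\<Sum>\<beta>\<in>Tn. e \<beta> * ?M (u \<beta>) \<alpha>)" for \<alpha>
    proof -
      have "?M w' \<alpha> = ?M w \<alpha> + (\<Sum>\<gamma>\<in>?G. \<Sum>\<beta>\<in>Tn. e \<beta> * (u \<beta> \<gamma> * (\<Prod>i\<in>UNIV. of_int (\<gamma> i) ^ \<alpha> i)))"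
        by (simp add: w'_def distrib_right sum.distrib sum_distrib_right mult.assoc)
      then show ?thesis
        by (subst (asm) sum.swap) (simp add: sum_distrib_left)
    qed
    have "?M w' \<alpha> = 0" if "\<exists>i. odd (\<alpha> i)" for \<alpha>
      using that w_odd[of \<alpha>] u_odd TnT unfolding M_w' by (auto intro!: sum.neutral)
    moreover have "?M w' (\<lambda>i. 2 * \<alpha> i) = L \<alpha>" if \<alpha>: "\<alpha> \<in> T" "sum \<alpha> UNIV < Suc n" for \<alpha>
    proof -
      have zero: "?M (u \<beta>) (\<lambda>i. 2 * \<alpha> i) = 0" if \<beta>: "\<beta> \<in> Tn" "\<beta> \<noteq> \<alpha>" for \<beta>
      proof -
        \<comment> \<open>Otherwise \<open>\<beta> \<le> \<alpha>\<close> pointwise; as the degree of \<open>\<alpha>\<close> is at most that of \<open>\<beta>\<close>, the two would agree.\<close>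
        have "\<exists>i. \<alpha> i < \<beta> i"
        proof (rule ccontr)
          assume "\<not> ?thesis"
          then have le: "\<beta> i \<le> \<alpha> i" for i by (auto simp: not_less)
          obtain i where "\<beta> i < \<alpha> i"
            using \<beta>(2) le by (metis ext le_neq_implies_less)
          then have "sum \<beta> UNIV < sum \<alpha> UNIV"
            using le by (intro sum_strict_mono_ex1) auto
          then show False
            using \<alpha> \<beta> by (simp add: Tn_def)
        qed
        then show ?thesis
          using u_below TnT[OF \<beta>(1)] by blast
      qed
      have "(\<Sum>\<beta>\<in>Tn. e \<beta> * ?M (u \<beta>) (\<lambda>i. 2 * \<alpha> i)) = (\<Sum>\<beta>\<in>Tn. if \<beta> = \<alpha> then e \<alpha> else 0)"
        by (rule sum.cong[OF refl]) (use zero u_diag \<alpha> in auto)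
      also have "\<dots> = (if \<alpha> \<in> Tn then e \<alpha> else 0)"
        using finTn by simp
      finally have "?M w' (\<lambda>i. 2 * \<alpha> i) = ?M w (\<lambda>i. 2 * \<alpha> i) + (if \<alpha> \<in> Tn then e \<alpha> else 0)"
        unfolding M_w' by simp
      then show ?thesis
        using \<alpha> w[of \<alpha>] by (auto simp: e_def Tn_def)
    qed
    ultimately show ?case by blast
  qed
  from this[of "Suc (\<Sum>\<beta>\<in>T. sum \<beta> UNIV)"] obtain w
    where w: "\<And>\<alpha>. \<exists>i. odd (\<alpha> i) \<Longrightarrow> ?M w \<alpha> = 0"
      "\<And>\<beta>. \<beta> \<in> T \<Longrightarrow> sum \<beta> UNIV < Suc (\<Sum>\<beta>\<in>T. sum \<beta> UNIV) \<Longrightarrow> ?M w (\<lambda>i. 2 * \<beta> i) = L \<beta>"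
    by blast
  show ?thesis
  proof (rule that[of w])
    show "?M w (\<lambda>i. 2 * \<beta> i) = L \<beta>" if "\<beta> \<in> T" for \<beta>
      using w(2)[OF that] member_le_sum[OF that, of "\<lambda>\<beta>. sum \<beta> UNIV"] fin by simp
  qed (use w(1) in blast)
qed

section \<open>Sparse exponents and the number of their signed points\<close>

text \<open>The halves of the exponents on which the dilated formula may fail, see
  \<open>nonsparse_exponents_squarefree\<close>.\<close>

definition sparse_exponents :: "nat \<Rightarrow> ('d::finite \<Rightarrow> nat) set" where
  "sparse_exponents k = {\<beta>. sum \<beta> UNIV \<le> k \<and> card {i. \<beta> i \<noteq> 0} < k}"

lemma finite_exponents_of_bounded_degree: "finite {\<alpha> :: 'd::finite \<Rightarrow> nat. sum \<alpha> UNIV \<le> l}"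
proof (rule finite_subset)
  show "{\<alpha> :: 'd \<Rightarrow> nat. sum \<alpha> UNIV \<le> l} \<subseteq> PiE UNIV (\<lambda>_. {..l})"
  proof (clarsimp simp: PiE_UNIV_domain)
    fix \<alpha> :: "'d \<Rightarrow> nat" and i
    assume "sum \<alpha> UNIV \<le> l"
    then show "\<alpha> i \<le> l"
      using member_le_sum[of i UNIV \<alpha>] by simp
  qed
qed (auto intro!: finite_PiE)

lemma down_closed_bounded_degree: "down_closed {\<alpha> :: 'd::finite \<Rightarrow> nat. sum \<alpha> UNIV \<le> l}"
  by (auto simp: down_closed_def intro: order.trans[OF sum_mono])

lemma finite_sparse_exponents: "finite (sparse_exponents k)"
  by (rule finite_subset[OF _ finite_exponents_of_bounded_degree[of k]]) (auto simp: sparse_exponents_def)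

lemma down_closed_sparse_exponents: "down_closed (sparse_exponents k :: ('d::finite \<Rightarrow> nat) set)"
  unfolding down_closed_def
proof (intro ballI allI impI)
  fix \<alpha> \<beta> :: "'d \<Rightarrow> nat"
  assume \<beta>: "\<beta> \<in> sparse_exponents k" and le: "\<forall>i. \<alpha> i \<le> \<beta> i"
  have "{i. \<alpha> i \<noteq> 0} \<subseteq> {i. \<beta> i \<noteq> 0}"
    using le by (auto intro: less_le_trans)
  then have "card {i. \<alpha> i \<noteq> 0} \<le> card {i. \<beta> i \<noteq> 0}"
    by (intro card_mono) auto
  moreover have "sum \<alpha> UNIV \<le> sum \<beta> UNIV"
    using le by (intro sum_mono) auto
  ultimately show "\<alpha> \<in> sparse_exponents k"
    using \<beta> by (auto simp: sparse_exponents_def)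
qed

text \<open>Multiply \<open>(d choose s) * fact s \<le> d ^ s\<close> by the \<open>k - 1 - s\<close> factors by which \<open>fact (k - 1)\<close>
  exceeds \<open>fact s\<close>, each of which is at most \<open>k - 1 \<le> d\<close>.\<close>

lemma binomial_le_power_div_fact:
  assumes "s < k" "k \<le> d"
  shows "real (d choose s) \<le> real d ^ (k - 1) / fact (k - 1)"
proof -
  let ?r = "k - 1 - s"
  have "fact (k - 1) div fact (k - 1 - ?r) \<le> (k - 1) ^ ?r"
    by (rule fact_div_fact_le_pow) simp
  moreover have "k - 1 - ?r = s" using assms by simp
  moreover have "(fact s :: nat) dvd fact (k - 1)" using assms by (intro fact_dvd) simp
  ultimately have "fact (k - 1) \<le> fact s * (k - 1) ^ ?r"
    by (metis dvd_mult_div_cancel mult_le_mono2)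
  also have "\<dots> \<le> fact s * d ^ ?r"
    using assms by (intro mult_le_mono2 power_mono) auto
  finally have "(d choose s) * fact (k - 1) \<le> (d choose s) * fact s * d ^ ?r"
    by (metis mult.assoc mult_le_mono2)
  also have "\<dots> \<le> d ^ s * d ^ ?r"
    by (intro mult_le_mono1) (simp add: binomial_fact_pow)
  also have "\<dots> = d ^ (k - 1)"
    using assms by (simp flip: power_add)
  finally have "real ((d choose s) * fact (k - 1)) \<le> real (d ^ (k - 1))"
    by (simp only: of_nat_le_iff)
  then show ?thesis by (simp add: field_simps)
qed

lemma sum_half_power_abs_le: "(\<Sum>m\<in>{-int k..int k} - {0}. (1/2::real) ^ nat \<bar>m\<bar>) \<le> 2"
proof -
  have split: "{-int k..int k} - {0} = {1..int k} \<union> {-int k..-1}" by auto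
  have pos: "(\<Sum>m\<in>{1..int k}. (1/2::real) ^ nat \<bar>m\<bar>) = (\<Sum>m=1..k. (1/2) ^ m)"
    by (rule sum.reindex_bij_witness[of _ int nat]) auto
  have neg: "(\<Sum>m\<in>{-int k..-1}. (1/2::real) ^ nat \<bar>m\<bar>) = (\<Sum>m=1..k. (1/2) ^ m)"
    by (rule sum.reindex_bij_witness[of _ "\<lambda>m. - int m" "\<lambda>m. nat (-m)"]) auto
  have "(\<Sum>m=1..k. (1/2::real) ^ m) = 1 - (1/2) ^ k"
    by (induction k) (auto simp: field_simps)
  then have "(\<Sum>m=1..k. (1/2::real) ^ m) \<le> 1" by simp
  then show ?thesis
    unfolding split by (subst sum.union_disjoint) (auto simp only: pos neg, auto)
qed

text \<open>Giving \<open>\<gamma>\<close> the weight \<open>2 ^ (k - \<bar>\<gamma>\<bar>)\<close>, with \<open>\<bar>\<gamma>\<bar>\<close> the sum of the \<open>\<bar>\<gamma> i\<bar>\<close>, counts every point at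
  least once; summed over all points with support \<open>U\<close>, these weights give \<open>2 ^ k\<close> times a product of
  two-sided geometric series, each of which is at most \<open>2\<close>.\<close>

lemma card_integer_points_with_support:
  fixes U :: "'d::finite set"
  shows "real (card {\<gamma> :: 'd \<Rightarrow> int. (\<Sum>i\<in>UNIV. nat \<bar>\<gamma> i\<bar>) \<le> k \<and> {i. \<gamma> i \<noteq> 0} = U}) \<le> 2 ^ k * 2 ^ card U"
    (is "real (card ?A) \<le> _")
proof -
  define B where "B i = (if i \<in> U then {-int k..int k} - {0} else {0})" for i
  have AB: "?A \<subseteq> PiE UNIV B"
  proof
    fix \<gamma> assume \<gamma>: "\<gamma> \<in> ?A"
    have "\<gamma> i \<in> {-int k..int k}" for i
      using \<gamma> member_le_sum[of i UNIV "\<lambda>i. nat \<bar>\<gamma> i\<bar>"] by auto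
    then show "\<gamma> \<in> PiE UNIV B"
      using \<gamma> by (auto simp: B_def PiE_UNIV_domain)
  qed
  have finB: "finite (PiE UNIV B)"
    by (rule finite_PiE) (auto simp: B_def)
  have "real (card ?A) = (\<Sum>\<gamma>\<in>?A. 1)" by simp
  also have "\<dots> \<le> (\<Sum>\<gamma>\<in>?A. 2 ^ k * (\<Prod>i\<in>UNIV. (1/2) ^ nat \<bar>\<gamma> i\<bar>))"
  proof (rule sum_mono)
    fix \<gamma> assume "\<gamma> \<in> ?A"
    then have "(1/2::real) ^ k \<le> (1/2) ^ (\<Sum>i\<in>UNIV. nat \<bar>\<gamma> i\<bar>)"
      by (intro power_decreasing) auto
    then show "(1::real) \<le> 2 ^ k * (\<Prod>i\<in>UNIV. (1/2) ^ nat \<bar>\<gamma> i\<bar>)"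
      by (simp add: power_sum field_simps)
  qed
  also have "\<dots> \<le> (\<Sum>\<gamma>\<in>PiE UNIV B. 2 ^ k * (\<Prod>i\<in>UNIV. (1/2) ^ nat \<bar>\<gamma> i\<bar>))"
    by (rule sum_mono2[OF finB AB]) (auto intro!: mult_nonneg_nonneg prod_nonneg)
  also have "\<dots> = 2 ^ k * (\<Prod>i\<in>UNIV. \<Sum>m\<in>B i. (1/2) ^ nat \<bar>m\<bar>)"
    unfolding sum_distrib_left[symmetric] by (subst prod_sum_PiE) (auto simp: B_def)
  also have "\<dots> \<le> 2 ^ k * (\<Prod>i\<in>UNIV. if i \<in> U then 2 else 1)"
    by (intro mult_left_mono prod_mono) (auto simp: B_def sum_half_power_abs_le intro!: sum_nonneg)
  also have "\<dots> = 2 ^ k * 2 ^ card U"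
    by (simp add: prod.If_cases)
  finally show ?thesis .
qed

lemma card_signed_sparse_exponents:
  assumes "k \<le> CARD('d::finite)"
  shows "real (card (signed_points (sparse_exponents k :: ('d \<Rightarrow> nat) set)))
    \<le> c_const k * real CARD('d) ^ (k - 1)"
proof -
  let ?D = "real CARD('d) ^ (k - 1) / fact (k - 1)"
  define A where "A U = {\<gamma> :: 'd \<Rightarrow> int. (\<Sum>i\<in>UNIV. nat \<bar>\<gamma> i\<bar>) \<le> k \<and> {i. \<gamma> i \<noteq> 0} = U}" for U
  let ?S = "{U :: 'd set. card U < k}"
  have "signed_points (sparse_exponents k) = (\<Union>U\<in>?S. A U)"
    by (auto simp: signed_points_def sparse_exponents_def A_def)
  then have "real (card (signed_points (sparse_exponents k :: ('d \<Rightarrow> nat) set))) \<le> real (\<Sum>U\<in>?S. card (A U))"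
    by (simp only: of_nat_le_iff) (rule card_UN_le, simp)
  also have "\<dots> \<le> (\<Sum>U\<in>?S. 2 ^ k * 2 ^ card U)"
    unfolding A_def of_nat_sum by (intro sum_mono card_integer_points_with_support)
  also have "\<dots> = (\<Sum>s<k. \<Sum>U | U \<in> ?S \<and> card U = s. 2 ^ k * 2 ^ card U)"
    by (rule sum.group[symmetric]) auto
  also have "\<dots> = (\<Sum>s<k. real (CARD('d) choose s) * (2 ^ k * 2 ^ s))"
  proof (rule sum.cong[OF refl])
    fix s assume "s \<in> {..<k}"
    then have "{U \<in> ?S. card U = s} = {U. U \<subseteq> UNIV \<and> card U = s}" by auto
    then show "(\<Sum>U | U \<in> ?S \<and> card U = s. 2 ^ k * 2 ^ card U) = real (CARD('d) choose s) * (2 ^ k * 2 ^ s)"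
      using n_subsets[of "UNIV :: 'd set" s] by simp
  qed
  also have "\<dots> \<le> (\<Sum>s<k. ?D * (2 ^ k * 2 ^ s))"
    using assms by (intro sum_mono mult_right_mono binomial_le_power_div_fact) auto
  also have "\<dots> = ?D * 2 ^ k * (\<Sum>s<k. 2 ^ s)"
    unfolding sum_distrib_left by (simp only: mult.assoc)
  also have "\<dots> \<le> ?D * 2 ^ k * 2 ^ k"
    by (intro mult_left_mono) (auto simp: geometric_sum)
  also have "\<dots> = c_const k * real CARD('d) ^ (k - 1)"
    by (simp add: c_const_def mult_2 power_add)
  finally show ?thesis .
qed

section \<open>Integrals of products of one-variable functions\<close>

lemma measurable_vec_of_PiM:
  "(\<lambda>f. \<chi> i. f i) \<in> (\<Pi>\<^sub>M i\<in>(UNIV::'d::finite set). (lborel::real measure)) \<rightarrow>\<^sub>M borel"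
  by (subst borel_measurable_euclidean_space) (auto simp: Basis_vec_def inner_axis)

text \<open>With \<open>'d\<close> itself as the index set of the product measure, Fubini's theorem for finite products
  speaks directly of the coordinates \<open>x $ i\<close>.\<close>

lemma lborel_vec_eq_distr_PiM:
  "(lborel :: (real ^ 'd) measure) = distr (\<Pi>\<^sub>M i\<in>UNIV. lborel) borel (\<lambda>f. \<chi> i. f i)"
proof (rule lborel_eqI)
  interpret product_sigma_finite "\<lambda>_::'d. lborel :: real measure"
    by standard
  fix l u :: "real ^ 'd"
  assume le: "\<And>b. b \<in> Basis \<Longrightarrow> l \<bullet> b \<le> u \<bullet> b"
  have le': "l $ i \<le> u $ i" for i
    using le[of "axis i 1"] by (simp add: axis_in_Basis_iff inner_axis)
  have box: "box l u \<in> sets borel"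
    by simp
  have pre: "(\<lambda>f. \<chi> i. f i) -` box l u \<inter> space (\<Pi>\<^sub>M i\<in>(UNIV::'d set). lborel) 
      = (\<Pi>\<^sub>E i\<in>UNIV. {l $ i <..< u $ i})"
    by (auto simp: space_PiM mem_box_cart PiE_def Pi_def)
  have "emeasure (distr (\<Pi>\<^sub>M i\<in>UNIV. lborel) borel (\<lambda>f. \<chi> i. f i)) (box l u)
      = emeasure (\<Pi>\<^sub>M i\<in>(UNIV::'d set). lborel) (\<Pi>\<^sub>E i\<in>UNIV. {l $ i <..< u $ i})"
    unfolding emeasure_distr[OF measurable_vec_of_PiM box] pre ..
  also have "\<dots> = (\<Prod>i\<in>UNIV. ennreal (u $ i - l $ i))"
    using le' by (subst emeasure_PiM) auto
  also have "\<dots> = ennreal (\<Prod>i\<in>UNIV. u $ i - l $ i)"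
    using le' by (subst prod_ennreal) auto
  also have "(\<Prod>i\<in>UNIV. u $ i - l $ i) = (\<Prod>b\<in>Basis. (u - l) \<bullet> b)"
    by (rule prod.reindex_bij_witness[of _ "\<lambda>b. SOME i. b = axis i 1" "\<lambda>i. axis i 1"])
       (auto simp: Basis_vec_def inner_axis axis_eq_axis)
  finally show "emeasure (distr (\<Pi>\<^sub>M i\<in>UNIV. lborel) borel (\<lambda>f. \<chi> i. f i)) (box l u)
      = ennreal (\<Prod>b\<in>Basis. (u - l) \<bullet> b)" .
qed simp

lemma
  fixes f :: "'d::finite \<Rightarrow> real \<Rightarrow> real"
  assumes f: "\<And>i. integrable lborel (f i)"
  shows integrable_lborel_vec_prod: "integrable lborel (\<lambda>x :: real ^ 'd. \<Prod>i\<in>UNIV. f i (x $ i))"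
    and integral_lborel_vec_prod:
      "integral\<^sup>L lborel (\<lambda>x :: real ^ 'd. \<Prod>i\<in>UNIV. f i (x $ i)) = (\<Prod>i\<in>UNIV. integral\<^sup>L lborel (f i))"
proof -
  interpret product_sigma_finite "\<lambda>_::'d. lborel :: real measure"
    by standard
  have [measurable]: "f i \<in> borel_measurable borel" for i
    using f[of i] by auto
  have *: "(\<lambda>x :: real ^ 'd. \<Prod>i\<in>UNIV. f i (x $ i)) \<in> borel_measurable borel"
    by measurable
  show "integrable lborel (\<lambda>x :: real ^ 'd. \<Prod>i\<in>UNIV. f i (x $ i))"
    unfolding lborel_vec_eq_distr_PiM using * product_integrable_prod[OF finite_class.finite_UNIV f]
    by (simp add: integrable_distr_eq measurable_vec_of_PiM)
  show "integral\<^sup>L lborel (\<lambda>x :: real ^ 'd. \<Prod>i\<in>UNIV. f i (x $ i)) = (\<Prod>i\<in>UNIV. integral\<^sup>L lborel (f i))"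
    unfolding lborel_vec_eq_distr_PiM using * product_integral_prod[OF finite_class.finite_UNIV f]
    by (simp add: integral_distr measurable_vec_of_PiM)
qed

text \<open>The cylinder over a null set is a product of sets one of which has measure \<open>0\<close>, so it is null, even
  though its other sides have infinite measure (as \<open>0 * \<infinity> = 0\<close>).\<close>

lemma AE_lborel_vec_component:
  fixes i :: "'d::finite"
  assumes "AE t in (lborel :: real measure). P t"
  shows "AE x in (lborel :: (real ^ 'd) measure). P (x $ i)"
proof -
  obtain N where N: "N \<in> sets borel" "emeasure lborel N = 0" "{t. \<not> P t} \<subseteq> N"
    using assms by (auto elim: AE_E)
  have [measurable]: "N \<in> sets borel" by fact
  interpret product_sigma_finite "\<lambda>_::'d. lborel :: real measure"
    by standard
  have eq: "{x :: real ^ 'd. x $ i \<in> N} = (\<lambda>x. x $ i) -` N \<inter> space borel"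
    by auto
  have meas: "{x :: real ^ 'd. x $ i \<in> N} \<in> sets borel"
    unfolding eq by (rule measurable_sets[OF _ N(1)]) measurable
  have pre: "(\<lambda>f. \<chi> i. f i) -` {x :: real ^ 'd. x $ i \<in> N} \<inter> space (\<Pi>\<^sub>M i\<in>(UNIV::'d set). lborel)
      = (\<Pi>\<^sub>E j\<in>UNIV. if j = i then N else UNIV)"
    by (auto simp: space_PiM PiE_def Pi_def split: if_splits)
  have "emeasure lborel {x :: real ^ 'd. x $ i \<in> N}
      = emeasure (\<Pi>\<^sub>M i\<in>(UNIV::'d set). lborel) (\<Pi>\<^sub>E j\<in>UNIV. if j = i then N else UNIV)"
    unfolding lborel_vec_eq_distr_PiM emeasure_distr[OF measurable_vec_of_PiM meas] pre ..
  also have "\<dots> = (\<Prod>j\<in>UNIV. emeasure lborel (if j = i then N else UNIV))"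
    using N by (intro emeasure_PiM) auto
  also have "\<dots> = 0"
    using N by (intro prod_zero) auto
  finally show ?thesis
    using N(3) meas by (intro AE_I[of _ _ "{x. x $ i \<in> N}"]) auto
qed

text \<open>Weights need only be Lebesgue measurable, while Fubini's theorem is available for Borel functions.
  Each factor is replaced by a Borel function that agrees with it almost everywhere; by
  \<open>AE_lborel_vec_component\<close> the products then agree almost everywhere as well.\<close>

lemma
  fixes f :: "'d::finite \<Rightarrow> real \<Rightarrow> real"
  assumes f: "\<And>i. integrable lebesgue (f i)"
  shows integrable_lebesgue_vec_prod: "integrable lebesgue (\<lambda>x :: real ^ 'd. \<Prod>i\<in>UNIV. f i (x $ i))"
    and integral_lebesgue_vec_prod:
      "integral\<^sup>L lebesgue (\<lambda>x :: real ^ 'd. \<Prod>i\<in>UNIV. f i (x $ i)) = (\<Prod>i\<in>UNIV. integral\<^sup>L lebesgue (f i))"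
proof -
  have "\<exists>g \<in> borel_measurable lborel. AE t in lborel. f i t = g t" for i
    using completion_ex_borel_measurable_real[of "f i" lborel] f[of i] by blast
  then obtain g where g [measurable]: "\<And>i. g i \<in> borel_measurable lborel"
    and fg: "\<And>i. AE t in lborel. f i t = g i t"
    by metis
  have fg': "AE t in lebesgue. f i t = g i t" for i
    using fg[of i] by (rule AE_completion)
  have gl: "g i \<in> borel_measurable lebesgue" for i
    using g[of i] by (rule measurable_completion)
  have "integrable lebesgue (g i)" for i
    using f[of i] fg'[of i] gl[of i] integrable_cong_AE[of "f i" lebesgue "g i"] by auto
  then have gint: "integrable lborel (g i)" for i
    using integrable_completion[of "g i" lborel] g by auto
  have fgint: "integral\<^sup>L lebesgue (f i) = integral\<^sup>L lborel (g i)" for i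
    using integral_cong_AE[of "f i" lebesgue "g i"] fg'[of i] gl[of i] f[of i]
      integral_completion[of "g i" lborel] g[of i] by simp
  let ?F = "\<lambda>x :: real ^ 'd. \<Prod>i\<in>UNIV. f i (x $ i)" and ?G = "\<lambda>x :: real ^ 'd. \<Prod>i\<in>UNIV. g i (x $ i)"
  have G: "?G \<in> borel_measurable lborel"
    by measurable
  have "AE x in (lborel :: (real ^ 'd) measure). \<forall>i\<in>UNIV. f i (x $ i) = g i (x $ i)"
    by (rule AE_finite_allI) (auto intro: AE_lborel_vec_component fg)
  then have FG: "AE x in lebesgue. ?G x = ?F x"
    by (intro AE_completion) auto
  have GL: "?G \<in> borel_measurable lebesgue"
    using G by (rule measurable_completion)
  have FL: "?F \<in> borel_measurable lebesgue"
    using GL FG by (rule borel_measurable_AE)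
  show "integrable lebesgue ?F"
    using integrable_cong_AE[OF GL FL FG] integrable_completion[OF G] integrable_lborel_vec_prod[of g, OF gint]
    by simp
  show "integral\<^sup>L lebesgue ?F = (\<Prod>i\<in>UNIV. integral\<^sup>L lebesgue (f i))"
    using integral_cong_AE[OF GL FL FG] integral_completion[OF G] integral_lborel_vec_prod[of g, OF gint]
      fgint by simp
qed

section \<open>Moments of symmetric product weights\<close>

definition moment :: "real set \<Rightarrow> (real \<Rightarrow> real) \<Rightarrow> nat \<Rightarrow> real" where
  "moment \<Omega> \<rho> p = (LINT x:\<Omega>|lebesgue. x ^ p * \<rho> x)"

lemma set_integrable_power_weight:
  assumes "symmetric_weight \<Omega> \<rho>"
  shows "set_integrable lebesgue \<Omega> (\<lambda>x. x ^ p * \<rho> x)"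
proof -
  have "(\<lambda>x. poly (monom 1 p) x * \<rho> x) absolutely_integrable_on \<Omega>"
    using assms unfolding symmetric_weight_def by blast
  then show ?thesis by (simp add: poly_monom)
qed

lemma moment_0_pos: "symmetric_weight \<Omega> \<rho> \<Longrightarrow> moment \<Omega> \<rho> 0 > 0"
  by (simp add: moment_def symmetric_weight_def)

lemma moment_odd:
  assumes \<Omega>: "symmetric_interval \<Omega>" and \<rho>: "symmetric_weight \<Omega> \<rho>" and p: "odd p"
  shows "moment \<Omega> \<rho> p = 0"
proof -
  let ?f = "\<lambda>x. x ^ p * \<rho> x"
  have int: "?f absolutely_integrable_on \<Omega>"
    using set_integrable_power_weight[OF \<rho>] .
  have neg: "uminus ` \<Omega> \<subseteq> \<Omega>"
    using \<Omega> by (auto simp: symmetric_interval_def)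
  have meas: "\<Omega> \<in> sets lebesgue"
    using \<Omega> by (auto simp: symmetric_interval_def dest: real_interval_borel_measurable)
  have odd: "?f (- x) = - ?f x" if "x \<in> \<Omega>" for x
    using \<rho> p that by (simp add: symmetric_weight_def)
  have "integral \<Omega> ?f = integral \<Omega> (\<lambda>x. ?f (- x))"
    using has_absolute_integral_reflect_real[OF neg neg meas, of ?f "integral \<Omega> ?f"] int by simp
  also have "\<dots> = integral \<Omega> (\<lambda>x. - ?f x)"
    using odd by (rule integral_cong)
  also have "\<dots> = - integral \<Omega> ?f" by simp
  finally show ?thesis
    unfolding moment_def using set_lebesgue_integral_eq_integral(2)[OF int] by simp
qed

text \<open>If the second moment vanished, \<open>x ^ 2 * \<rho> x\<close> and hence \<open>\<rho>\<close> would be zero almost everywhere on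
  \<open>\<Omega>\<close>, against the positive total mass.\<close>

lemma moment_2_pos:
  assumes \<rho>: "symmetric_weight \<Omega> \<rho>"
  shows "moment \<Omega> \<rho> 2 > 0"
proof -
  let ?g = "\<lambda>x. indicator \<Omega> x *\<^sub>R (x ^ 2 * \<rho> x)"
  have nonneg: "\<rho> x \<ge> 0" if "x \<in> \<Omega>" for x
    using \<rho> that unfolding symmetric_weight_def by blast
  then have g_nonneg: "?g x \<ge> 0" for x
    by (simp add: indicator_def)
  have g_int: "integrable lebesgue ?g"
    using set_integrable_power_weight[OF \<rho>, of 2] by (simp add: set_integrable_def)
  have "moment \<Omega> \<rho> 2 \<noteq> 0"
  proof
    assume "moment \<Omega> \<rho> 2 = 0"
    then have "integral\<^sup>L lebesgue ?g = 0"
      by (simp add: moment_def set_lebesgue_integral_def)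
    then have "AE x in lebesgue. ?g x = 0"
      using integral_nonneg_eq_0_iff_AE[OF g_int] g_nonneg by simp
    moreover have "AE x in lebesgue. x \<noteq> (0::real)"
      by (intro AE_completion AE_lborel_singleton)
    ultimately have "AE x in lebesgue. indicator \<Omega> x *\<^sub>R \<rho> x = 0"
      by eventually_elim auto
    then have "(LINT x:\<Omega>|lebesgue. \<rho> x) = 0"
      unfolding set_lebesgue_integral_def by (rule integral_eq_zero_AE)
    then show False
      using \<rho> by (simp add: symmetric_weight_def)
  qed
  moreover have "moment \<Omega> \<rho> 2 \<ge> 0"
    unfolding moment_def set_lebesgue_integral_def using g_nonneg by (intro integral_nonneg_AE) auto
  ultimately show ?thesis by simp
qed

definition monomial :: "('d \<Rightarrow> nat) \<Rightarrow> (real ^ 'd::finite) \<Rightarrow> real" where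
  "monomial \<alpha> x = (\<Prod>i\<in>UNIV. (x $ i) ^ \<alpha> i)"

lemma
  fixes \<Omega> :: "'d::finite \<Rightarrow> real set" and \<rho> :: "'d \<Rightarrow> real \<Rightarrow> real"
  assumes \<rho>: "\<And>i. symmetric_weight (\<Omega> i) (\<rho> i)"
  shows set_integrable_monomial_product_weight:
      "set_integrable lebesgue (product_region \<Omega>) (\<lambda>x. monomial \<alpha> x * product_weight \<rho> x)"
    and weighted_integral_monomial:
      "weighted_integral (product_region \<Omega>) (product_weight \<rho>) (monomial \<alpha>)
        = (\<Prod>i\<in>UNIV. moment (\<Omega> i) (\<rho> i) (\<alpha> i))"
proof -
  define f where "f i t = indicator (\<Omega> i) t *\<^sub>R (t ^ \<alpha> i * \<rho> i t)" for i and t :: real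
  have f: "integrable lebesgue (f i)" for i
    using set_integrable_power_weight[OF \<rho>[of i], of "\<alpha> i"] by (simp add: set_integrable_def f_def [abs_def])
  have eq: "indicator (product_region \<Omega>) x *\<^sub>R (monomial \<alpha> x * product_weight \<rho> x)
      = (\<Prod>i\<in>UNIV. f i (x $ i))" for x
  proof (cases "x \<in> product_region \<Omega>")
    case True
    then show ?thesis
      by (simp add: f_def monomial_def product_weight_def product_region_def prod.distrib)
  next
    case False
    then obtain i where "x $ i \<notin> \<Omega> i"
      by (auto simp: product_region_def)
    then have "f i (x $ i) = 0"
      by (simp add: f_def)
    then have "(\<Prod>i\<in>UNIV. f i (x $ i)) = 0"
      by (intro prod_zero) auto
    then show ?thesis
      using False by simp
  qed
  show "set_integrable lebesgue (product_region \<Omega>) (\<lambda>x. monomial \<alpha> x * product_weight \<rho> x)"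
    unfolding set_integrable_def eq by (rule integrable_lebesgue_vec_prod[OF f])
  show "weighted_integral (product_region \<Omega>) (product_weight \<rho>) (monomial \<alpha>)
      = (\<Prod>i\<in>UNIV. moment (\<Omega> i) (\<rho> i) (\<alpha> i))"
    unfolding weighted_integral_def set_lebesgue_integral_def eq integral_lebesgue_vec_prod[OF f]
    by (simp add: moment_def set_lebesgue_integral_def f_def [abs_def])
qed

lemma monomial_in_polynomials_upto:
  fixes \<alpha> :: "'d::finite \<Rightarrow> nat"
  assumes "sum \<alpha> UNIV \<le> l"
  shows "monomial \<alpha> \<in> polynomials_upto l"
  unfolding polynomials_upto_def
proof (intro CollectI exI ext)
  fix x :: "real ^ 'd"
  have "(\<Sum>\<beta> | sum \<beta> UNIV \<le> l. (if \<beta> = \<alpha> then 1 else 0) * (\<Prod>i\<in>UNIV. (x $ i) ^ \<beta> i))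
      = (\<Sum>\<beta> | sum \<beta> UNIV \<le> l. if \<beta> = \<alpha> then \<Prod>i\<in>UNIV. (x $ i) ^ \<alpha> i else 0)"
    by (intro sum.cong refl) simp
  then show "monomial \<alpha> x = (\<Sum>\<beta> | sum \<beta> UNIV \<le> l. (if \<beta> = \<alpha> then 1 else 0) * (\<Prod>i\<in>UNIV. (x $ i) ^ \<beta> i))"
    using assms by (simp add: monomial_def finite_exponents_of_bounded_degree)
qed

text \<open>Both sides of the exactness condition are linear in the polynomial, the integral because every
  monomial is integrable against the weight. All further work is on moments.\<close>

lemma exact_iff_exact_on_monomials:
  fixes \<Omega> :: "'d::finite \<Rightarrow> real set" and \<rho> :: "'d \<Rightarrow> real \<Rightarrow> real"
  assumes \<rho>: "\<And>i. symmetric_weight (\<Omega> i) (\<rho> i)"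
  shows "has_degree_of_exactness l (product_region \<Omega>) (product_weight \<rho>) n a x \<longleftrightarrow>
    (\<forall>\<alpha>. sum \<alpha> UNIV \<le> l \<longrightarrow> cubature n a x (monomial \<alpha>) = (\<Prod>i\<in>UNIV. moment (\<Omega> i) (\<rho> i) (\<alpha> i)))"
proof
  assume "has_degree_of_exactness l (product_region \<Omega>) (product_weight \<rho>) n a x"
  then show "\<forall>\<alpha>. sum \<alpha> UNIV \<le> l \<longrightarrow> cubature n a x (monomial \<alpha>) = (\<Prod>i\<in>UNIV. moment (\<Omega> i) (\<rho> i) (\<alpha> i))"
    using monomial_in_polynomials_upto
    by (auto simp: has_degree_of_exactness_def simp flip: weighted_integral_monomial[of \<Omega> \<rho>, OF \<rho>])
next
  assume ex: "\<forall>\<alpha>. sum \<alpha> UNIV \<le> l \<longrightarrow> cubature n a x (monomial \<alpha>) = (\<Prod>i\<in>UNIV. moment (\<Omega> i) (\<rho> i) (\<alpha> i))"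
  show "has_degree_of_exactness l (product_region \<Omega>) (product_weight \<rho>) n a x"
    unfolding has_degree_of_exactness_def
  proof
    fix f :: "real ^ 'd \<Rightarrow> real" assume "f \<in> polynomials_upto l"
    then obtain c where f: "f = (\<lambda>x. \<Sum>\<alpha> | sum \<alpha> UNIV \<le> l. c \<alpha> * monomial \<alpha> x)"
      by (auto simp: polynomials_upto_def monomial_def)
    have "weighted_integral (product_region \<Omega>) (product_weight \<rho>) f
        = (LINT x:product_region \<Omega>|lebesgue. (\<Sum>\<alpha> | sum \<alpha> UNIV \<le> l. c \<alpha> * (monomial \<alpha> x * product_weight \<rho> x)))"
      by (simp add: weighted_integral_def f sum_distrib_right mult.assoc)
    also have "\<dots> = (\<Sum>\<alpha> | sum \<alpha> UNIV \<le> l. LINT x:product_region \<Omega>|lebesgue. c \<alpha> * (monomial \<alpha> x * product_weight \<rho> x))"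
      using set_integrable_monomial_product_weight[of \<Omega> \<rho>, OF \<rho>]
      unfolding set_lebesgue_integral_def scaleR_sum_right
      by (intro Bochner_Integration.integral_sum)
         (simp add: set_integrable_def mult.left_commute[of "indicator _ _"])
    also have "\<dots> = (\<Sum>\<alpha> | sum \<alpha> UNIV \<le> l. c \<alpha> * weighted_integral (product_region \<Omega>) (product_weight \<rho>) (monomial \<alpha>))"
      by (simp add: weighted_integral_def)
    also have "\<dots> = (\<Sum>\<alpha> | sum \<alpha> UNIV \<le> l. c \<alpha> * cubature n a x (monomial \<alpha>))"
      using ex by (intro sum.cong refl) (simp add: weighted_integral_monomial[of \<Omega> \<rho>, OF \<rho>])
    also have "\<dots> = cubature n a x f"
      unfolding cubature_def f sum_distrib_left by (subst sum.swap) (simp add: mult_ac)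
    finally show "cubature n a x f = weighted_integral (product_region \<Omega>) (product_weight \<rho>) f" ..
  qed
qed

section \<open>Repairing a formula by interpolation of its defect\<close>

lemma symmetric_interval_neighbourhood:
  assumes "symmetric_interval \<Omega>"
  obtains e where "e > 0" "{-e..e} \<subseteq> \<Omega>"
proof -
  obtain z where z: "z \<in> \<Omega>" "z \<noteq> 0"
    using assms unfolding symmetric_interval_def by metis
  moreover have "- z \<in> \<Omega>"
    using assms z(1) unfolding symmetric_interval_def by blast
  ultimately have "\<bar>z\<bar> \<in> \<Omega>" "- \<bar>z\<bar> \<in> \<Omega>"
    by (simp_all add: abs_if)
  then have "{- \<bar>z\<bar>..\<bar>z\<bar>} \<subseteq> \<Omega>"
    using assms unfolding symmetric_interval_def is_interval_1 by (meson atLeastAtMost_iff subsetI)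
  then show ?thesis
    using that[of "\<bar>z\<bar>"] z by simp
qed

text \<open>Every factor of the region is a neighbourhood of \<open>0\<close>, so any finite configuration of points can be
  shrunk into it.\<close>

lemma small_dilation_in_product_region:
  fixes \<Omega> :: "'d::finite \<Rightarrow> real set" and P :: "('d \<Rightarrow> real) set"
  assumes \<Omega>: "\<And>i. symmetric_interval (\<Omega> i)" and fin: "finite P"
  obtains t where "t > 0" "\<And>p. p \<in> P \<Longrightarrow> (\<chi> i. t * p i) \<in> product_region \<Omega>"
proof -
  have "\<exists>e>0. {-e..e} \<subseteq> \<Omega> i" for i
    by (rule symmetric_interval_neighbourhood[OF \<Omega>[of i]]) blast
  then have "\<exists>e. \<forall>i. e i > 0 \<and> {- e i..e i} \<subseteq> \<Omega> i"
    by (intro choice) blast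
  then obtain e where e: "\<And>i. e i > 0" "\<And>i. {- e i..e i} \<subseteq> \<Omega> i"
    by blast
  define B where "B = 1 + (\<Sum>p\<in>P. \<Sum>i\<in>UNIV. \<bar>p i\<bar> / e i)"
  have nonneg: "(\<Sum>i\<in>UNIV. \<bar>p i\<bar> / e i) \<ge> 0" for p
    using e(1) by (intro sum_nonneg) (simp add: less_imp_le)
  have B: "B > 0"
    unfolding B_def by (intro add_pos_nonneg sum_nonneg[of P] nonneg) simp
  have "1 / B * p i \<in> \<Omega> i" if "p \<in> P" for p i
  proof -
    have "\<bar>p i\<bar> / e i \<le> (\<Sum>i\<in>UNIV. \<bar>p i\<bar> / e i)"
      using e(1) by (intro member_le_sum) (auto simp: less_imp_le)
    also have "\<dots> \<le> (\<Sum>p\<in>P. \<Sum>i\<in>UNIV. \<bar>p i\<bar> / e i)"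
      using nonneg that fin by (intro member_le_sum) auto
    also have "\<dots> \<le> B" by (simp add: B_def)
    finally have "\<bar>1 / B * p i\<bar> \<le> e i"
      using e(1)[of i] B by (simp add: field_simps abs_mult)
    then have "- e i \<le> 1 / B * p i" "1 / B * p i \<le> e i"
      by linarith+
    then have "1 / B * p i \<in> {- e i..e i}"
      by (simp only: atLeastAtMost_iff)
    then show ?thesis
      using e(2) by blast
  qed
  then show ?thesis
    using that[of "1 / B"] B by (simp add: product_region_def)
qed

lemma monomial_dilation:
  "monomial \<alpha> (\<chi> i. t * p i) = t ^ sum \<alpha> UNIV * (\<Prod>i\<in>UNIV. p i ^ \<alpha> i)"
  by (simp add: monomial_def power_mult_distrib prod.distrib power_sum)

lemma cubature_append:
  assumes "finite G"
  obtains a' x' where "\<And>f. cubature (n + card G) a' x' f = cubature n a x f + (\<Sum>\<gamma>\<in>G. w \<gamma> * f (y \<gamma>))"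
    and "\<And>i. i < n \<Longrightarrow> x' i = x i" and "\<And>i. n \<le> i \<Longrightarrow> i < n + card G \<Longrightarrow> x' i \<in> y ` G"
proof -
  obtain h where h: "bij_betw h {0..<card G} G"
    using ex_bij_betw_nat_finite[OF assms] by blast
  define a' where "a' i = (if i < n then a i else w (h (i - n)))" for i
  define x' where "x' i = (if i < n then x i else y (h (i - n)))" for i
  have "cubature (n + card G) a' x' f = cubature n a x f + (\<Sum>\<gamma>\<in>G. w \<gamma> * f (y \<gamma>))" for f
  proof -
    have "{..<n + card G} = {..<n} \<union> {n..<n + card G}" by auto
    then have "cubature (n + card G) a' x' f
        = (\<Sum>i<n. a' i * f (x' i)) + (\<Sum>i=n..<n + card G. a' i * f (x' i))"
      unfolding cubature_def by (simp add: sum.union_disjoint ivl_disj_int)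
    also have "(\<Sum>i=n..<n + card G. a' i * f (x' i)) = (\<Sum>j=0..<card G. w (h j) * f (y (h j)))"
      by (rule sum.reindex_bij_witness[of _ "\<lambda>j. j + n" "\<lambda>i. i - n"]) (auto simp: a'_def x'_def)
    also have "\<dots> = (\<Sum>\<gamma>\<in>G. w \<gamma> * f (y \<gamma>))"
      by (rule sum.reindex_bij_betw[OF h])
    finally show ?thesis
      by (simp add: cubature_def a'_def x'_def)
  qed
  moreover have "x' i \<in> y ` G" if "n \<le> i" "i < n + card G" for i
    using that bij_betwE[OF h] by (auto simp: x'_def)
  ultimately show ?thesis
    using that[of a' x'] by (simp add: x'_def)
qed

definition admits_cubature :: "nat \<Rightarrow> ('d::finite \<Rightarrow> real set) \<Rightarrow> ('d \<Rightarrow> real \<Rightarrow> real) \<Rightarrow> nat \<Rightarrow> bool" where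
  "admits_cubature l \<Omega> \<rho> n \<longleftrightarrow> (\<exists>a x. (\<forall>i<n. x i \<in> product_region \<Omega>) \<and>
     has_degree_of_exactness l (product_region \<Omega>) (product_weight \<rho>) n a x)"

text \<open>A formula is completed to an exact one by knots at small multiples of the signed points of \<open>T\<close>,
  weighted such that they interpolate the defect on \<open>T\<close>. For this to be enough, the formula must
  already be exact on all other monomials, and the new knots must not see them: on the odd ones by
  symmetry, on the even ones outside \<open>T\<close> because each new knot has a vanishing coordinate in them.\<close>

lemma admits_cubature_of_interpolated_defect:
  fixes \<Omega> :: "'d::finite \<Rightarrow> real set" and \<rho> :: "'d \<Rightarrow> real \<Rightarrow> real" and T :: "('d \<Rightarrow> nat) set"
  assumes \<Omega>: "\<And>i. symmetric_interval (\<Omega> i)" and \<rho>: "\<And>i. symmetric_weight (\<Omega> i) (\<rho> i)"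
    and T: "finite T" "down_closed T"
    and knots: "\<And>i. i < n \<Longrightarrow> x i \<in> product_region \<Omega>"
    and odd: "\<And>\<alpha>. sum \<alpha> UNIV \<le> l \<Longrightarrow> \<exists>i. odd (\<alpha> i) \<Longrightarrow> cubature n a x (monomial \<alpha>) = 0"
    and exact: "\<And>\<beta>. 2 * sum \<beta> UNIV \<le> l \<Longrightarrow> \<beta> \<notin> T \<Longrightarrow>
      cubature n a x (monomial (\<lambda>i. 2 * \<beta> i)) = (\<Prod>i\<in>UNIV. moment (\<Omega> i) (\<rho> i) (2 * \<beta> i))"
    and vanish: "\<And>\<beta> \<gamma>. 2 * sum \<beta> UNIV \<le> l \<Longrightarrow> \<beta> \<notin> T \<Longrightarrow> \<gamma> \<in> signed_points T \<Longrightarrow> \<exists>i. \<gamma> i = 0 \<and> \<beta> i \<noteq> 0"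
  shows "admits_cubature l \<Omega> \<rho> (n + card (signed_points T))"
proof -
  let ?G = "signed_points T" and ?M = "\<lambda>\<alpha>. \<Prod>i\<in>UNIV. moment (\<Omega> i) (\<rho> i) (\<alpha> i)"
  have finG: "finite ?G" using T(1) by (rule finite_signed_points)
  obtain h :: real where h: "h > 0" "\<And>p. p \<in> (\<lambda>\<gamma> i. of_int (\<gamma> i)) ` ?G \<Longrightarrow> (\<chi> i. h * p i) \<in> product_region \<Omega>"
    by (rule small_dilation_in_product_region[of \<Omega> "(\<lambda>\<gamma> i. of_int (\<gamma> i)) ` ?G", OF \<Omega> finite_imageI[OF finG]]) (rule that)
  define y :: "('d \<Rightarrow> int) \<Rightarrow> real ^ 'd" where "y \<gamma> = (\<chi> i. h * of_int (\<gamma> i))" for \<gamma>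
  \<comment> \<open>The defect, divided by the factor that the dilation by \<open>h\<close> puts on the monomial.\<close>
  define L where "L \<beta> = (?M (\<lambda>i. 2 * \<beta> i) - cubature n a x (monomial (\<lambda>i. 2 * \<beta> i))) / h ^ (\<Sum>i\<in>UNIV. 2 * \<beta> i)" for \<beta>
  obtain w :: "('d \<Rightarrow> int) \<Rightarrow> real"
    where w_odd: "\<And>\<alpha>. \<exists>i. odd (\<alpha> i) \<Longrightarrow> (\<Sum>\<gamma>\<in>?G. w \<gamma> * (\<Prod>i\<in>UNIV. of_int (\<gamma> i) ^ \<alpha> i)) = 0"
      and w_T: "\<And>\<beta>. \<beta> \<in> T \<Longrightarrow> (\<Sum>\<gamma>\<in>?G. w \<gamma> * (\<Prod>i\<in>UNIV. of_int (\<gamma> i) ^ (2 * \<beta> i))) = L \<beta>"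
    by (rule interpolation_down_closed[OF T, of L]) (rule that)
  obtain a' x' where
    a': "\<And>f. cubature (n + card ?G) a' x' f = cubature n a x f + (\<Sum>\<gamma>\<in>?G. w \<gamma> * f (y \<gamma>))"
    and x': "\<And>i. i < n \<Longrightarrow> x' i = x i" "\<And>i. n \<le> i \<Longrightarrow> i < n + card ?G \<Longrightarrow> x' i \<in> y ` ?G"
    by (rule cubature_append[OF finG, where n = n and a = a and x = x and w = w and y = y]) (rule that)
  have corr: "(\<Sum>\<gamma>\<in>?G. w \<gamma> * monomial \<alpha> (y \<gamma>))
      = h ^ sum \<alpha> UNIV * (\<Sum>\<gamma>\<in>?G. w \<gamma> * (\<Prod>i\<in>UNIV. of_int (\<gamma> i) ^ \<alpha> i))" for \<alpha>
    by (simp add: y_def monomial_dilation sum_distrib_left mult_ac)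
  have "cubature (n + card ?G) a' x' (monomial \<alpha>) = ?M \<alpha>" if deg: "sum \<alpha> UNIV \<le> l" for \<alpha>
  proof (cases "\<exists>i. odd (\<alpha> i)")
    case True
    then obtain i where "moment (\<Omega> i) (\<rho> i) (\<alpha> i) = 0"
      using moment_odd[OF \<Omega> \<rho>] by blast
    then have "?M \<alpha> = 0"
      by (intro prod_zero bexI[of _ i]) simp_all
    then show ?thesis
      using True odd[OF deg] w_odd[of \<alpha>] by (simp add: a' corr)
  next
    case False
    define \<beta> where "\<beta> i = \<alpha> i div 2" for i
    have \<alpha>: "\<alpha> = (\<lambda>i. 2 * \<beta> i)" using False by (auto simp: \<beta>_def)
    have deg': "2 * sum \<beta> UNIV \<le> l"
      using deg by (simp add: \<alpha> sum_distrib_left)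
    show ?thesis
    proof (cases "\<beta> \<in> T")
      case True
      then show ?thesis
        unfolding a' corr \<alpha> w_T[OF True] using h(1) by (simp add: L_def)
    next
      case False
      have "(\<Prod>i\<in>UNIV. real_of_int (\<gamma> i) ^ (2 * \<beta> i)) = 0" if \<gamma>: "\<gamma> \<in> ?G" for \<gamma>
      proof -
        obtain i where "\<gamma> i = 0" "\<beta> i \<noteq> 0"
          using vanish[OF deg' False \<gamma>] by blast
        then show ?thesis
          by (intro prod_zero bexI[of _ i]) simp_all
      qed
      then have "(\<Sum>\<gamma>\<in>?G. w \<gamma> * (\<Prod>i\<in>UNIV. real_of_int (\<gamma> i) ^ (2 * \<beta> i))) = 0"
        by (intro sum.neutral ballI) simp
      then show ?thesis
        unfolding a' corr \<alpha> using exact[OF deg' False] by simp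
    qed
  qed
  moreover have "x' i \<in> product_region \<Omega>" if "i < n + card ?G" for i
  proof (cases "i < n")
    case False
    then have "x' i \<in> y ` ?G" using x'(2) that by simp
    then show ?thesis using h(2) by (auto simp: y_def)
  qed (use x'(1) knots in auto)
  ultimately show ?thesis
    unfolding admits_cubature_def exact_iff_exact_on_monomials[of \<Omega> \<rho>, OF \<rho>] by (intro exI[of _ a'] exI[of _ x']) blast
qed

text \<open>Without such a formula the minimal number of knots would have no meaning. The empty formula has
  all of the moments as its defect, and here \<open>T\<close> contains every exponent that matters.\<close>

lemma cubature_exists:
  fixes \<Omega> :: "'d::finite \<Rightarrow> real set" and \<rho> :: "'d \<Rightarrow> real \<Rightarrow> real"
  assumes "\<And>i. symmetric_interval (\<Omega> i)" and "\<And>i. symmetric_weight (\<Omega> i) (\<rho> i)"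
  shows "\<exists>n. admits_cubature l \<Omega> \<rho> n"
proof
  show "admits_cubature l \<Omega> \<rho> (0 + card (signed_points {\<beta> :: 'd \<Rightarrow> nat. sum \<beta> UNIV \<le> l}))"
    by (rule admits_cubature_of_interpolated_defect[of \<Omega> \<rho>, OF assms
          finite_exponents_of_bounded_degree down_closed_bounded_degree,
          where a = "\<lambda>_. 0" and x = "\<lambda>_. 0"])
       (simp_all add: cubature_def)
qed

text \<open>At least \<open>k\<close> exponents are positive while their sum is at most \<open>k\<close>, so there are exactly \<open>k\<close>
  positive ones, all equal to \<open>1\<close>.\<close>

lemma nonsparse_exponents_squarefree:
  fixes \<beta> :: "'d::finite \<Rightarrow> nat"
  assumes deg: "sum \<beta> UNIV \<le> k" and "\<beta> \<notin> sparse_exponents k"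
  shows "sum \<beta> UNIV = k" and "\<beta> i \<le> 1"
proof -
  let ?S = "{i. \<beta> i \<noteq> 0}"
  have card: "card ?S \<ge> k"
    using assms by (simp add: sparse_exponents_def)
  have split: "sum \<beta> UNIV = card ?S + (\<Sum>i\<in>?S. \<beta> i - 1)"
  proof -
    have "sum \<beta> UNIV = sum \<beta> ?S"
      by (rule sum.mono_neutral_right) auto
    also have "\<dots> = (\<Sum>i\<in>?S. 1 + (\<beta> i - 1))"
      by (rule sum.cong) auto
    finally show ?thesis unfolding sum.distrib by simp
  qed
  show "sum \<beta> UNIV = k" using split card deg by simp
  have "(\<Sum>i\<in>?S. \<beta> i - 1) = 0" using split card deg by linarith
  then show "\<beta> i \<le> 1" by (cases "\<beta> i = 0") auto
qed

section \<open>Transfer of a formula from one weight to another\<close>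

text \<open>The dilation of the given formula and the repair of its defect, put together. The factors \<open>r i\<close> and
  \<open>s i\<close> are determined by the wish (\<open>match\<close>) that weights multiplied by \<open>r i\<close> and knots dilated by
  \<open>s i\<close> turn the moments of orders \<open>0\<close> and \<open>2\<close> in coordinate \<open>i\<close> into the new ones. The common
  dilation \<open>t\<close> brings the knots into the new region.\<close>

lemma cubature_transfer:
  fixes \<Omega>1 \<Omega>2 :: "'d::finite \<Rightarrow> real set" and \<rho>1 \<rho>2 :: "'d \<Rightarrow> real \<Rightarrow> real"
  assumes \<Omega>1: "\<And>i. symmetric_interval (\<Omega>1 i)" and \<rho>1: "\<And>i. symmetric_weight (\<Omega>1 i) (\<rho>1 i)"
    and \<Omega>2: "\<And>i. symmetric_interval (\<Omega>2 i)" and \<rho>2: "\<And>i. symmetric_weight (\<Omega>2 i) (\<rho>2 i)"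
    and n: "admits_cubature (2 * k + 1) \<Omega>1 \<rho>1 n"
  shows "admits_cubature (2 * k + 1) \<Omega>2 \<rho>2 (n + card (signed_points (sparse_exponents k :: ('d \<Rightarrow> nat) set)))"
proof -
  let ?m1 = "\<lambda>i. moment (\<Omega>1 i) (\<rho>1 i)" and ?m2 = "\<lambda>i. moment (\<Omega>2 i) (\<rho>2 i)"
  obtain a x where exact: "\<And>\<alpha>. sum \<alpha> UNIV \<le> 2 * k + 1 \<Longrightarrow> cubature n a x (monomial \<alpha>) = (\<Prod>i\<in>UNIV. ?m1 i (\<alpha> i))"
    using n unfolding admits_cubature_def exact_iff_exact_on_monomials[of \<Omega>1 \<rho>1, OF \<rho>1] by blast
  define r where "r i = ?m2 i 0 / ?m1 i 0" for i
  define s where "s i = sqrt (?m2 i 2 / (r i * ?m1 i 2))" for i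
  have r: "r i > 0" for i
    by (simp add: r_def moment_0_pos[OF \<rho>1] moment_0_pos[OF \<rho>2])
  have s2: "s i ^ 2 = ?m2 i 2 / (r i * ?m1 i 2)" for i
    using moment_2_pos[OF \<rho>1, of i] moment_2_pos[OF \<rho>2, of i] r[of i] by (simp add: s_def)
  have match: "r i * (s i ^ (2 * b) * ?m1 i (2 * b)) = ?m2 i (2 * b)" if "b \<le> 1" for i and b :: nat
  proof (cases "b = 0")
    case True
    then show ?thesis
      using moment_0_pos[OF \<rho>1, of i] by (simp add: r_def)
  next
    case False
    then have "b = 1" using that by simp
    then show ?thesis
      using moment_2_pos[OF \<rho>1, of i] r[of i] by (simp add: s2)
  qed
  obtain t where t: "t > 0" "\<And>p. p \<in> (\<lambda>l i. s i * (x l $ i)) ` {..<n} \<Longrightarrow> (\<chi> i. t * p i) \<in> product_region \<Omega>2"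
    by (rule small_dilation_in_product_region[of \<Omega>2 "(\<lambda>l i. s i * (x l $ i)) ` {..<n}",
          OF \<Omega>2 finite_imageI[OF finite_lessThan]]) (rule that)
  \<comment> \<open>The denominator cancels the effect of \<open>t\<close> in degree \<open>2 * k\<close>, which is the degree of all
    monomials \<open>x ^ (2 * \<beta>)\<close> that the dilated formula has to get right by itself.\<close>
  define c where "c = (\<Prod>i\<in>UNIV. r i) / t ^ (2 * k)"
  define x' where "x' l = (\<chi> i. t * (s i * (x l $ i)))" for l
  have mono: "monomial \<alpha> (x' l) = t ^ sum \<alpha> UNIV * ((\<Prod>i\<in>UNIV. s i ^ \<alpha> i) * monomial \<alpha> (x l))" for \<alpha> l
    unfolding x'_def monomial_dilation by (simp add: monomial_def power_mult_distrib prod.distrib)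
  have cub: "cubature n (\<lambda>l. c * a l) x' (monomial \<alpha>)
      = c * t ^ sum \<alpha> UNIV * (\<Prod>i\<in>UNIV. s i ^ \<alpha> i * ?m1 i (\<alpha> i))" if "sum \<alpha> UNIV \<le> 2 * k + 1" for \<alpha>
  proof -
    have "cubature n (\<lambda>l. c * a l) x' (monomial \<alpha>)
        = c * t ^ sum \<alpha> UNIV * (\<Prod>i\<in>UNIV. s i ^ \<alpha> i) * cubature n a x (monomial \<alpha>)"
      by (simp add: cubature_def mono sum_distrib_left mult_ac)
    then show ?thesis
      using exact[OF that] by (simp add: prod.distrib)
  qed
  show ?thesis
  proof (rule admits_cubature_of_interpolated_defect[OF \<Omega>2 \<rho>2 finite_sparse_exponents
        down_closed_sparse_exponents, where a = "\<lambda>l. c * a l" and x = x'])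
    show "x' l \<in> product_region \<Omega>2" if "l < n" for l
      using t(2) that by (auto simp: x'_def)
    show "cubature n (\<lambda>l. c * a l) x' (monomial \<alpha>) = 0"
      if "sum \<alpha> UNIV \<le> 2 * k + 1" and odd: "\<exists>i. odd (\<alpha> i)" for \<alpha>
    proof -
      obtain i where "?m1 i (\<alpha> i) = 0"
        using odd moment_odd[OF \<Omega>1 \<rho>1] by blast
      then have "(\<Prod>i\<in>UNIV. s i ^ \<alpha> i * ?m1 i (\<alpha> i)) = 0"
        by (intro prod_zero bexI[of _ i]) simp_all
      then show ?thesis using cub[OF that(1)] by simp
    qed
  next
    fix \<beta> :: "'d \<Rightarrow> nat"
    assume deg: "2 * sum \<beta> UNIV \<le> 2 * k + 1" and \<beta>: "\<beta> \<notin> sparse_exponents k"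
    have "sum \<beta> UNIV \<le> k" using deg by simp
    note sqf = nonsparse_exponents_squarefree[OF this \<beta>]
    have deg2: "(\<Sum>i\<in>UNIV. 2 * \<beta> i) = 2 * k"
      using sqf(1) by (simp flip: sum_distrib_left)
    have "cubature n (\<lambda>l. c * a l) x' (monomial (\<lambda>i. 2 * \<beta> i))
        = (\<Prod>i\<in>UNIV. r i) * (\<Prod>i\<in>UNIV. s i ^ (2 * \<beta> i) * ?m1 i (2 * \<beta> i))"
      using cub[of "\<lambda>i. 2 * \<beta> i"] deg2 t(1) by (simp add: c_def)
    also have "\<dots> = (\<Prod>i\<in>UNIV. r i * (s i ^ (2 * \<beta> i) * ?m1 i (2 * \<beta> i)))"
      by (simp only: prod.distrib)
    also have "\<dots> = (\<Prod>i\<in>UNIV. ?m2 i (2 * \<beta> i))"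
      by (intro prod.cong refl match sqf(2))
    finally show "cubature n (\<lambda>l. c * a l) x' (monomial (\<lambda>i. 2 * \<beta> i)) = (\<Prod>i\<in>UNIV. ?m2 i (2 * \<beta> i))" .
    fix \<gamma> :: "'d \<Rightarrow> int" assume "\<gamma> \<in> signed_points (sparse_exponents k)"
    then have "card {i. \<gamma> i \<noteq> 0} < card {i. \<beta> i \<noteq> 0}"
      using \<beta> \<open>sum \<beta> UNIV \<le> k\<close> by (simp add: signed_points_def sparse_exponents_def)
    then have "\<not> {i. \<beta> i \<noteq> 0} \<subseteq> {i. \<gamma> i \<noteq> 0}"
      using card_mono[of "{i. \<gamma> i \<noteq> 0}" "{i. \<beta> i \<noteq> 0}"] by auto
    then show "\<exists>i. \<gamma> i = 0 \<and> \<beta> i \<noteq> 0" by blast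
  qed
qed

lemma N_min_le_N_min_plus:
  fixes \<Omega>1 \<Omega>2 :: "'d::finite \<Rightarrow> real set" and \<rho>1 \<rho>2 :: "'d \<Rightarrow> real \<Rightarrow> real"
  assumes 1: "\<And>i. symmetric_interval (\<Omega>1 i)" "\<And>i. symmetric_weight (\<Omega>1 i) (\<rho>1 i)"
    and 2: "\<And>i. symmetric_interval (\<Omega>2 i)" "\<And>i. symmetric_weight (\<Omega>2 i) (\<rho>2 i)"
    and k: "k \<le> CARD('d)"
  shows "real (N_min (2 * k + 1) (product_region \<Omega>2) (product_weight \<rho>2))
    \<le> real (N_min (2 * k + 1) (product_region \<Omega>1) (product_weight \<rho>1)) + c_const k * real CARD('d) ^ (k - 1)"
proof -
  let ?N = "\<lambda>\<Omega> \<rho>. N_min (2 * k + 1) (product_region \<Omega>) (product_weight \<rho>)"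
  have N_min: "?N \<Omega> \<rho> = (LEAST n. admits_cubature (2 * k + 1) \<Omega> \<rho> n)" for \<Omega> :: "'d \<Rightarrow> real set" and \<rho>
    by (simp add: N_min_def admits_cubature_def)
  have "admits_cubature (2 * k + 1) \<Omega>1 \<rho>1 (?N \<Omega>1 \<rho>1)"
    unfolding N_min using cubature_exists[OF 1] by (rule LeastI_ex)
  then have "?N \<Omega>2 \<rho>2 \<le> ?N \<Omega>1 \<rho>1 + card (signed_points (sparse_exponents k :: ('d \<Rightarrow> nat) set))"
    unfolding N_min[of \<Omega>2] by (intro Least_le cubature_transfer[OF 1 2])
  then show ?thesis
    using card_signed_sparse_exponents[OF k] by linarith
qed

theorem theorem2:
  fixes k :: nat
    and \<Omega>1 \<Omega>2 :: "'d::finite \<Rightarrow> real set"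
    and \<rho>1 \<rho>2 :: "'d \<Rightarrow> real \<Rightarrow> real"
  assumes "k \<ge> 2" and "CARD('d) \<ge> k"
    and "\<And>i. symmetric_interval (\<Omega>1 i)" and "\<And>i. symmetric_weight (\<Omega>1 i) (\<rho>1 i)"
    and "\<And>i. symmetric_interval (\<Omega>2 i)" and "\<And>i. symmetric_weight (\<Omega>2 i) (\<rho>2 i)"
  shows "\<bar>real (N_min (2 * k + 1) (product_region \<Omega>1) (product_weight \<rho>1))
          - real (N_min (2 * k + 1) (product_region \<Omega>2) (product_weight \<rho>2))\<bar>
         \<le> c_const k * real CARD('d) ^ (k - 1)"
  using N_min_le_N_min_plus[of \<Omega>1 \<rho>1 \<Omega>2 \<rho>2, OF assms(3-6,2)] N_min_le_N_min_plus[of \<Omega>2 \<rho>2 \<Omega>1 \<rho>1, OF assms(5,6,3,4,2)]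
  by (intro abs_leI) linarith+

end
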